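(* Let $n\ge 2$ and $\mathcal{O}\in\mathcal{C}_{sg}^{(n)}$. Suppose that $\mathcal{O}\stackrel{\mathsf{p}}{\sim}\mathcal{O}'\stackrel{\mathsf{w}}{\sim}\mathcal{O}''$ or $\mathcal{O}\stackrel{\mathsf{w}}{\sim}\mathcal{O}'\stackrel{\mathsf{p}}{\sim}\mathcal{O}''$ with $\mathcal{O}''\in\mathcal{C}_{sp}^{(n)}$, and that the weak equivalence relation is given by a chain in canonical form containing $d$ shift equivalences. Let $0<\nu\le1$. Then there is a constant $\zeta_{n,\nu}$ depending only on $n$ and $\nu$ such that for any $d+1$ Jacobi operators $\mathcal{J}_1,\dots,\mathcal{J}_{d+1}\in\mathbf{J}_{\mathcal{O}}^{\nu}$, $$\|\mathcal{J}_1\mathcal{J}_2\cdots\mathcal{J}_{d+1}\|_2\le\zeta_{n,\nu},\qquad 0\le\zeta_{n,\nu}<1.$$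
   Context: $\imath=\sqrt{-1}$. For $1\le i<j\le n$ and real $\phi,\alpha$, $R(i,j,\phi,\alpha)$ is the $n\times n$ matrix equal to $I_n$ except for entries $(i,i)=(j,j)=\cos\phi$, $(i,j)=-e^{\imath\alpha}\sin\phi$, $(j,i)=e^{-\imath\alpha}\sin\phi$. Let $N=n(n-1)/2$. For $A=(a_{st})\in\mathbb{C}^{n\times n}$ let $c_t=(a_{1t},\dots,a_{t-1,t})^T$, $r_s=(a_{s1},\dots,a_{s,s-1})$ and $\mathrm{ve}(A)=[c_2^T,\dots,c_n^T,r_2,\dots,r_n]^T\in\mathbb{C}^{2N}$. Let $\nu_{ij}$ set entries $(i,j),(j,i)$ of a matrix to zero. The Jacobi annihilator $\mathcal{R}_{ij}(U)$, $U=R(i,j,\phi,\alpha)$, is the $2N\times2N$ matrix with $\mathcal{R}_{ij}(U)\mathrm{ve}(A)=\mathrm{ve}(\nu_{ij}(U^*AU))$ for all $A$; $\mathbf{R}_{ij}^{\nu}=\{\mathcal{R}_{ij}(U):U=R(i,j,\phi,\alpha),|\cos\phi|\ge\nu\}$. Let $\mathcal{P}_n=\{(r,s):1\le r<s\le n\}$; an ordering is a sequence listing each element of $\mathcal{P}_n$ exactly once. For an ordering $\mathcal{O}=(i_0,j_0),\dots,(i_{N-1},j_{N-1})$, $\mathbf{J}_{\mathcal{O}}^{\nu}=\{\mathcal{R}_{i_{N-1}j_{N-1}}\cdots\mathcal{R}_{i_0j_0}:\mathcal{R}_{i_kj_k}\in\mathbf{R}_{i_kj_k}^{\nu}\}$;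 $\|\cdot\|_2$ is the spectral norm. Relations on orderings: an admissible transposition swaps two adjacent pairs $(i_r,j_r),(i_{r+1},j_{r+1})$ with $\{i_r,j_r\}\cap\{i_{r+1},j_{r+1}\}=\emptyset$; $\mathcal{O}\sim\mathcal{O}'$ (equivalent) if one is obtained from the other by finitely many admissible transpositions; $\mathcal{O}\stackrel{\mathsf{s}}{\sim}\mathcal{O}'$ (shift-equivalent) if $\mathcal{O}=[\mathcal{O}_1,\mathcal{O}_2]$ and $\mathcal{O}'=[\mathcal{O}_2,\mathcal{O}_1]$ (concatenation); $\mathcal{O}\stackrel{\mathsf{w}}{\sim}\mathcal{O}'$ (weak equivalent) if there is a chain $\mathcal{O}=\mathcal{O}_0,\mathcal{O}_1,\dots,\mathcal{O}_r=\mathcal{O}'$ of orderings in which each two adjacent terms are equivalent or shift-equivalent; such a chain is in canonical form if the relations between consecutive terms alternate between $\sim$ and $\stackrel{\mathsf{s}}{\sim}$. $\mathcal{O}\stackrel{\mathsf{p}}{\sim}\mathcal{O}'$ (permutation equivalent) if there is a permutation $\mathsf{q}$ of $\{1,\dots,n\}$ such that $\mathcal{O}'$ is obtained by replacing each pair $(i_k,j_k)$ of $\mathcal{O}$ by the pair with entries $\mathsf{q}(i_k),\mathsf{q}(j_k)$ (written in increasing order). $\mathcal{C}_c^{(n)}$ is the set of orderings $(1,2),(\tau_3(1),3),(\tau_3(2),3),\dots,(\tau_n(1),n),\dots,(\tau_n(n-1),n)$, $\tau_j$ a permutation of $\{1,\dots,j-1\}$; $\mathcal{C}_r^{(n)}$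 is the set of orderings $(n-1,n),(n-2,\tau_{n-2}(n-1)),(n-2,\tau_{n-2}(n)),\dots,(1,\tau_1(2)),\dots,(1,\tau_1(n))$, $\tau_i$ a permutation of $\{i+1,\dots,n\}$; with reverses $\overleftarrow{\mathcal{C}}_c^{(n)},\overleftarrow{\mathcal{C}}_r^{(n)}$ (sets of orderings whose reversed sequence lies in $\mathcal{C}_c^{(n)}$, resp. $\mathcal{C}_r^{(n)}$), $\mathcal{C}_{sp}^{(n)}=\mathcal{C}_c^{(n)}\cup\overleftarrow{\mathcal{C}}_c^{(n)}\cup\mathcal{C}_r^{(n)}\cup\overleftarrow{\mathcal{C}}_r^{(n)}$. The class of generalized serial orderings $\mathcal{C}_{sg}^{(n)}$ is the set of orderings $\mathcal{O}$ for which there are orderings $\mathcal{O}'$ and $\mathcal{O}''\in\mathcal{C}_{sp}^{(n)}$ with $\mathcal{O}\stackrel{\mathsf{p}}{\sim}\mathcal{O}'\stackrel{\mathsf{w}}{\sim}\mathcal{O}''$ or $\mathcal{O}\stackrel{\mathsf{w}}{\sim}\mathcal{O}'\stackrel{\mathsf{p}}{\sim}\mathcal{O}''$, the weak equivalence being given in canonical form. *)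

theory Defs
  imports Complex_Main "HOL-Combinatorics.Permutations" "Jordan_Normal_Form.Matrix"
begin

(* n x n matrices are JNF matrices with 0-based indices: the paper's entry (s,t),
   1 <= s,t <= n, is the JNF entry (s-1,t-1).  Pairs (i,j) in orderings are 1-based as in the paper. *)

definition rotJ :: "nat \<Rightarrow> nat \<Rightarrow> nat \<Rightarrow> real \<Rightarrow> real \<Rightarrow> complex mat" where
  "rotJ n i j \<phi> \<alpha> = mat n n (\<lambda>(s,t).
     if s = i - 1 \<and> t = i - 1 then complex_of_real (cos \<phi>)
     else if s = j - 1 \<and> t = j - 1 then complex_of_real (cos \<phi>)
     else if s = i - 1 \<and> t = j - 1 then - exp (\<i> * complex_of_real \<alpha>) * complex_of_real (sin \<phi>)
     else if s = j - 1 \<and> t = i - 1 then exp (- \<i> * complex_of_real \<alpha>) * complex_of_real (sin \<phi>)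
     else if s = t then 1 else 0)"

definition cadj :: "complex mat \<Rightarrow> complex mat" where
  "cadj U = mat (dim_col U) (dim_row U) (\<lambda>(s,t). cnj (U $$ (t,s)))"

definition annul :: "nat \<Rightarrow> nat \<Rightarrow> complex mat \<Rightarrow> complex mat" where
  "annul i j A = mat (dim_row A) (dim_col A) (\<lambda>(s,t).
     if (s = i - 1 \<and> t = j - 1) \<or> (s = j - 1 \<and> t = i - 1) then 0 else A $$ (s,t))"

definition ve :: "nat \<Rightarrow> complex mat \<Rightarrow> complex vec" where
  "ve n A = vec_of_list
     (concat (map (\<lambda>t. map (\<lambda>s. A $$ (s - 1, t - 1)) [1..<t]) [2..<n+1]) @
      concat (map (\<lambda>s. map (\<lambda>t. A $$ (s - 1, t - 1)) [1..<s]) [2..<n+1]))"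

definition twoN :: "nat \<Rightarrow> nat" where "twoN n = n * (n - 1)"

definition is_annihilator :: "nat \<Rightarrow> nat \<Rightarrow> nat \<Rightarrow> complex mat \<Rightarrow> complex mat \<Rightarrow> bool" where
  "is_annihilator n i j U M \<longleftrightarrow> M \<in> carrier_mat (twoN n) (twoN n) \<and>
     (\<forall>A \<in> carrier_mat n n. M *\<^sub>v ve n A = ve n (annul i j (cadj U * A * U)))"

definition Rnu :: "nat \<Rightarrow> real \<Rightarrow> nat \<times> nat \<Rightarrow> complex mat set" where
  "Rnu n \<nu> p = {M. \<exists>\<phi> \<alpha>. \<bar>cos \<phi>\<bar> \<ge> \<nu> \<and> is_annihilator n (fst p) (snd p) (rotJ n (fst p) (snd p) \<phi> \<alpha>) M}"

fun Jnu :: "nat \<Rightarrow> real \<Rightarrow> (nat \<times> nat) list \<Rightarrow> complex mat set" where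
  "Jnu n \<nu> [] = {1\<^sub>m (twoN n)}"
| "Jnu n \<nu> (p # Q) = {M * R | M R. M \<in> Jnu n \<nu> Q \<and> R \<in> Rnu n \<nu> p}"

definition vnorm2 :: "complex vec \<Rightarrow> real" where
  "vnorm2 x = sqrt (\<Sum>k<dim_vec x. (cmod (x $ k))\<^sup>2)"

definition spec_norm :: "complex mat \<Rightarrow> real" where
  "spec_norm M = Sup {vnorm2 (M *\<^sub>v x) | x. x \<in> carrier_vec (dim_col M) \<and> vnorm2 x \<le> 1}"

definition Pn :: "nat \<Rightarrow> (nat \<times> nat) set" where
  "Pn n = {(r,s). 1 \<le> r \<and> r < s \<and> s \<le> n}"

definition is_ordering :: "nat \<Rightarrow> (nat \<times> nat) list \<Rightarrow> bool" where
  "is_ordering n Q \<longleftrightarrow> distinct Q \<and> set Q = Pn n"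

definition adm_transp :: "(nat \<times> nat) list \<Rightarrow> (nat \<times> nat) list \<Rightarrow> bool" where
  "adm_transp Q Q' \<longleftrightarrow> (\<exists>xs p q ys. Q = xs @ [p, q] @ ys \<and> Q' = xs @ [q, p] @ ys \<and>
      {fst p, snd p} \<inter> {fst q, snd q} = {})"

definition ord_equiv :: "(nat \<times> nat) list \<Rightarrow> (nat \<times> nat) list \<Rightarrow> bool" where
  "ord_equiv Q Q' \<longleftrightarrow> adm_transp\<^sup>*\<^sup>* Q Q'"

definition shift_equiv :: "(nat \<times> nat) list \<Rightarrow> (nat \<times> nat) list \<Rightarrow> bool" where
  "shift_equiv Q Q' \<longleftrightarrow> (\<exists>L1 L2. Q = L1 @ L2 \<and> Q' = L2 @ L1)"

(* weak equivalence Q ~w Q' given by a chain of orderings in canonical form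
   (relations alternate between ~ and ~s) containing exactly d shift equivalences.
   rels ! k = True means chain!k ~s chain!(k+1), False means chain!k ~ chain!(k+1). *)
definition weak_equiv_canon :: "nat \<Rightarrow> (nat \<times> nat) list \<Rightarrow> (nat \<times> nat) list \<Rightarrow> nat \<Rightarrow> bool" where
  "weak_equiv_canon n Q Q' d \<longleftrightarrow> (\<exists>chain rels.
     length chain = length rels + 1 \<and> chain ! 0 = Q \<and> chain ! length rels = Q' \<and>
     (\<forall>c \<in> set chain. is_ordering n c) \<and>
     (\<forall>k < length rels. if rels ! k then shift_equiv (chain ! k) (chain ! Suc k)
                                     else ord_equiv (chain ! k) (chain ! Suc k)) \<and>
     (\<forall>k. Suc k < length rels \<longrightarrow> rels ! k \<noteq> rels ! Suc k) \<and>
     d = length (filter id rels))"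

definition perm_equiv :: "nat \<Rightarrow> (nat \<times> nat) list \<Rightarrow> (nat \<times> nat) list \<Rightarrow> bool" where
  "perm_equiv n Q Q' \<longleftrightarrow> is_ordering n Q \<and> is_ordering n Q' \<and>
     (\<exists>q. q permutes {1..n} \<and>
        Q' = map (\<lambda>(i,j). (min (q i) (q j), max (q i) (q j))) Q)"

definition Cc :: "nat \<Rightarrow> (nat \<times> nat) list set" where
  "Cc n = {Q. \<exists>\<tau>. (\<forall>j \<in> {2..n}. \<tau> j permutes {1..j-1}) \<and>
     Q = concat (map (\<lambda>j. map (\<lambda>k. (\<tau> j k, j)) [1..<j]) [2..<n+1])}"

definition Cr :: "nat \<Rightarrow> (nat \<times> nat) list set" where
  "Cr n = {Q. \<exists>\<tau>. (\<forall>i \<in> {1..n-1}. \<tau> i permutes {i+1..n}) \<and>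
     Q = concat (map (\<lambda>i. map (\<lambda>k. (i, \<tau> i k)) [i+1..<n+1]) (rev [1..<n]))}"

definition Csp :: "nat \<Rightarrow> (nat \<times> nat) list set" where
  "Csp n = Cc n \<union> rev ` Cc n \<union> Cr n \<union> rev ` Cr n"

definition Csg :: "nat \<Rightarrow> (nat \<times> nat) list set" where
  "Csg n = {Q. \<exists>Q' Q'' d. Q'' \<in> Csp n \<and>
     ((perm_equiv n Q Q' \<and> weak_equiv_canon n Q' Q'' d) \<or>
      (weak_equiv_canon n Q Q' d \<and> perm_equiv n Q' Q''))}"

end

theory Submission
  imports Defs "HOL-Analysis.Function_Topology" "HOL-Analysis.Topology_Euclidean_Space"
begin

text \<open>
  An annihilator deletes the two pivot entries and acts unitarily on the remaining off-diagonal
  entries, so a product of annihilators preserves the norm of a vector only if every pivot entry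
  is already zero when its turn comes. Such lossless paths are stable under time reversal,
  admissible transpositions and relabelling, and a lossless path through $m+1$ sweeps of an
  ordering contains one through $m$ sweeps of any of its shifts. Hence a lossless path through
  $d+1$ sweeps of a generalized serial ordering yields one through a single sweep of a column-wise
  or row-wise ordering, where nonvanishing cosines force all entries to be zero.
  The admissible rotation parameters form a compact set, so the absence of nonzero lossless paths
  gives a bound below 1 for each ordering, and there are only finitely many orderings.
\<close>

section \<open>The action of an annihilator on off-diagonal entries\<close>

text \<open>
  Here $U_{ii} = U_{jj} = c$, $U_{ij} = -s$ and $U_{ji} = \bar s$. States are indexed from 1, as the
  pairs of an ordering are. The diagonal entries at the pivot positions are deleted as well; they
  are invisible to \<^const>\<open>ve\<close>, and the four deleted entries are then exactly the loss of norm.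
\<close>

definition jact :: "nat \<Rightarrow> nat \<Rightarrow> real \<Rightarrow> complex \<Rightarrow> (nat \<times> nat \<Rightarrow> complex) \<Rightarrow> nat \<times> nat \<Rightarrow> complex" where
  "jact i j c s x = (\<lambda>(k,l).
     if k \<in> {i,j} \<and> l \<in> {i,j} then 0
     else if k = i then of_real c * x (i,l) + s * x (j,l)
     else if k = j then of_real c * x (j,l) - cnj s * x (i,l)
     else if l = i then of_real c * x (k,i) + cnj s * x (k,j)
     else if l = j then of_real c * x (k,j) - s * x (k,i)
     else x (k,l))"

text \<open>The squared Frobenius norm of the n x n block. The diagonal is included so that the loss
  in one step is exactly the pivot block, a sum of four squares.\<close>

definition nsq :: "nat \<Rightarrow> (nat \<times> nat \<Rightarrow> complex) \<Rightarrow> real" where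
  "nsq n x = (\<Sum>k\<in>{1..n}. \<Sum>l\<in>{1..n}. (cmod (x (k,l)))\<^sup>2)"

text \<open>The 2 x 2 matrix with rows (c, s) and (-cnj s, c) is unitary.\<close>

lemma cmod_sq_rotate:
  fixes c :: real and s a b :: complex
  assumes "c\<^sup>2 + (cmod s)\<^sup>2 = 1"
  shows "(cmod (of_real c * a + s * b))\<^sup>2 + (cmod (of_real c * b - cnj s * a))\<^sup>2
       = (cmod a)\<^sup>2 + (cmod b)\<^sup>2"
proof -
  have "(cmod (of_real c * a + s * b))\<^sup>2 + (cmod (of_real c * b - cnj s * a))\<^sup>2
      = (c\<^sup>2 + (cmod s)\<^sup>2) * ((cmod a)\<^sup>2 + (cmod b)\<^sup>2)"
    unfolding cmod_power2 by (simp add: power2_eq_square algebra_simps)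
  with assms show ?thesis by simp
qed

text \<open>The four groups are those on which a rotation with pivot (i,j) acts separately:
  untouched entries, two columns, two rows, and the deleted pivot block.\<close>

lemma nsq_split:
  assumes "i \<in> {1..n}" "j \<in> {1..n}" "i \<noteq> j"
  defines "T \<equiv> {1..n} - {i,j}"
  shows "nsq n x =
     (\<Sum>k\<in>T. \<Sum>l\<in>T. (cmod (x (k,l)))\<^sup>2)
     + (\<Sum>k\<in>T. (cmod (x (k,i)))\<^sup>2 + (cmod (x (k,j)))\<^sup>2)
     + (\<Sum>l\<in>T. (cmod (x (i,l)))\<^sup>2 + (cmod (x (j,l)))\<^sup>2)
     + ((cmod (x (i,i)))\<^sup>2 + (cmod (x (i,j)))\<^sup>2 + (cmod (x (j,i)))\<^sup>2 + (cmod (x (j,j)))\<^sup>2)"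
proof -
  have split: "(\<Sum>k\<in>{1..n}. f k) = f i + f j + (\<Sum>k\<in>T. f k)" for f :: "nat \<Rightarrow> real"
  proof -
    have "{1..n} = insert i (insert j T)" using assms by auto
    moreover have "finite T" "i \<notin> T" "j \<notin> T" by (auto simp: T_def)
    ultimately show ?thesis using assms(3) by simp
  qed
  show ?thesis
    unfolding nsq_def split by (simp add: sum.distrib)
qed

lemma nsq_jact:
  assumes "i \<in> {1..n}" "j \<in> {1..n}" "i \<noteq> j" and cs: "c\<^sup>2 + (cmod s)\<^sup>2 = 1"
  shows "nsq n x = nsq n (jact i j c s x)
    + ((cmod (x (i,i)))\<^sup>2 + (cmod (x (i,j)))\<^sup>2 + (cmod (x (j,i)))\<^sup>2 + (cmod (x (j,j)))\<^sup>2)"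
proof -
  \<comment> \<open>Columns are rotated with cnj s in place of s.\<close>
  have cs': "c\<^sup>2 + (cmod (cnj s))\<^sup>2 = 1" using cs by simp
  have r: "(cmod (jact i j c s x (i,l)))\<^sup>2 + (cmod (jact i j c s x (j,l)))\<^sup>2
     = (cmod (x (i,l)))\<^sup>2 + (cmod (x (j,l)))\<^sup>2" if "l \<in> {1..n} - {i,j}" for l
    using that assms(3) cmod_sq_rotate[OF cs, of "x (i,l)" "x (j,l)"] by (auto simp: jact_def)
  have co: "(cmod (jact i j c s x (k,i)))\<^sup>2 + (cmod (jact i j c s x (k,j)))\<^sup>2
     = (cmod (x (k,i)))\<^sup>2 + (cmod (x (k,j)))\<^sup>2" if "k \<in> {1..n} - {i,j}" for k
    using that assms(3) cmod_sq_rotate[OF cs', of "x (k,i)" "x (k,j)"] by (auto simp: jact_def)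
  have T: "(\<Sum>k\<in>{1..n} - {i,j}. \<Sum>l\<in>{1..n} - {i,j}. (cmod (jact i j c s x (k,l)))\<^sup>2)
     = (\<Sum>k\<in>{1..n} - {i,j}. \<Sum>l\<in>{1..n} - {i,j}. (cmod (x (k,l)))\<^sup>2)"
    by (intro sum.cong refl) (auto simp: jact_def)
  have z: "jact i j c s x (i,i) = 0" "jact i j c s x (i,j) = 0" "jact i j c s x (j,i) = 0"
    "jact i j c s x (j,j) = 0" by (auto simp: jact_def)
  show ?thesis
    unfolding nsq_split[OF assms(1-3)] T z
    by (simp only: sum.cong[OF refl r] sum.cong[OF refl co]) simp
qed

text \<open>The rotation with parameters (c, -s) undoes that with (c, s). The pivot block has to
  vanish beforehand, because its deletion cannot be undone.\<close>

lemma jact_inverse: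
  assumes "i \<noteq> j" "c\<^sup>2 + (cmod s)\<^sup>2 = 1"
    and "x (i,i) = 0" "x (i,j) = 0" "x (j,i) = 0" "x (j,j) = 0"
  shows "jact i j c (- s) (jact i j c s x) = x"
proof -
  have cs: "of_real c * of_real c + s * cnj s = (1::complex)"
    using assms(2) by (metis complex_norm_square of_real_1 of_real_add of_real_mult power2_eq_square)
  have "of_real c * (of_real c * a + s * b) - s * (of_real c * b - cnj s * a)
      = (of_real c * of_real c + s * cnj s) * a"
    "of_real c * (of_real c * b - cnj s * a) + cnj s * (of_real c * a + s * b)
      = (of_real c * of_real c + s * cnj s) * b"
    "of_real c * (of_real c * a + cnj s * b) - cnj s * (of_real c * b - s * a)
      = (of_real c * of_real c + s * cnj s) * a"
    "of_real c * (of_real c * b - s * a) + s * (of_real c * a + cnj s * b)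
      = (of_real c * of_real c + s * cnj s) * b" for a b
    by (simp_all add: algebra_simps)
  note u = this[unfolded cs mult_1]
  show ?thesis
    using assms(1,3-) u by (auto simp: jact_def fun_eq_iff)
qed

text \<open>Makes the orientation of a pivot pair immaterial, as is needed once a relabelling has
  reversed the order of its two indices.\<close>

lemma jact_swap:
  "i \<noteq> j \<Longrightarrow> jact j i c (- cnj s) x = jact i j c s x"
  by (auto simp: jact_def fun_eq_iff)

text \<open>With disjoint pivots, an entry touched by both actions is touched by one through its row
  and by the other through its column, and left and right multiplications commute.\<close>

lemma jact_commute:
  assumes "i \<noteq> j" "i' \<noteq> j'" "{i,j} \<inter> {i',j'} = {}"
  shows "jact i j c s (jact i' j' c' s' x) = jact i' j' c' s' (jact i j c s x)"
proof
  have ne: "i \<noteq> j" "j \<noteq> i" "i' \<noteq> j'" "j' \<noteq> i'" "i \<noteq> i'" "i' \<noteq> i" "i \<noteq> j'" "j' \<noteq> i"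
    "j \<noteq> i'" "i' \<noteq> j" "j \<noteq> j'" "j' \<noteq> j"
    using assms by blast+
  fix p :: "nat \<times> nat"
  obtain k l where p: "p = (k,l)" by (cases p)
  consider "k = i" | "k = j" | "k = i'" | "k = j'" | "k \<noteq> i" "k \<noteq> j" "k \<noteq> i'" "k \<noteq> j'" by blast
  note k = this
  consider "l = i" | "l = j" | "l = i'" | "l = j'" | "l \<noteq> i" "l \<noteq> j" "l \<noteq> i'" "l \<noteq> j'" by blast
  note l = this
  show "jact i j c s (jact i' j' c' s' x) p = jact i' j' c' s' (jact i j c s x) p"
    unfolding p by (cases rule: k; cases rule: l; simp add: jact_def ne algebra_simps)
qed

lemma jact_relabel:
  assumes "inj q"
  shows "jact (q i) (q j) c s x (q k, q l) = jact i j c s (\<lambda>(k,l). x (q k, q l)) (k,l)"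
  using assms by (auto simp: jact_def inj_eq)

section \<open>Lossless paths\<close>

text \<open>The head of the list acts first. Pairs (c, s) replace the angles \<phi>, \<alpha>
  because they range over a compact set.\<close>

fun reach :: "real \<Rightarrow> (nat \<times> nat) list \<Rightarrow> (nat \<times> nat \<Rightarrow> complex) \<Rightarrow> (nat \<times> nat \<Rightarrow> complex) \<Rightarrow> bool" where
  "reach \<nu> [] x y \<longleftrightarrow> y = x"
| "reach \<nu> (p # L) x y \<longleftrightarrow> (\<exists>c s. \<nu> \<le> \<bar>c\<bar> \<and> c\<^sup>2 + (cmod s)\<^sup>2 = 1 \<and>
     reach \<nu> L (jact (fst p) (snd p) c s x) y)"

text \<open>A step without loss of norm: by \<open>nsq_jact\<close> the pivot block has to be zero.
  Only \<open>c \<noteq> 0\<close> is kept of the bound on the cosine, so the notion does not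
  involve \<nu>.\<close>

definition iso_step :: "nat \<times> nat \<Rightarrow> (nat \<times> nat \<Rightarrow> complex) \<Rightarrow> (nat \<times> nat \<Rightarrow> complex) \<Rightarrow> bool" where
  "iso_step = (\<lambda>(i,j) x y. i \<noteq> j \<and> x (i,i) = 0 \<and> x (i,j) = 0 \<and> x (j,i) = 0 \<and> x (j,j) = 0 \<and>
     (\<exists>c s. c \<noteq> 0 \<and> c\<^sup>2 + (cmod s)\<^sup>2 = 1 \<and> y = jact i j c s x))"

fun iso_path :: "(nat \<times> nat) list \<Rightarrow> (nat \<times> nat \<Rightarrow> complex) \<Rightarrow> (nat \<times> nat \<Rightarrow> complex) \<Rightarrow> bool" where
  "iso_path [] x y \<longleftrightarrow> y = x"
| "iso_path (p # L) x y \<longleftrightarrow> (\<exists>z. iso_step p x z \<and> iso_path L z y)"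

lemma reach_append: "reach \<nu> (L @ L') x y \<longleftrightarrow> (\<exists>z. reach \<nu> L x z \<and> reach \<nu> L' z y)"
  by (induction L arbitrary: x) auto

lemma iso_path_append: "iso_path (L @ L') x y \<longleftrightarrow> (\<exists>z. iso_path L x z \<and> iso_path L' z y)"
  by (induction L arbitrary: x) auto

lemma reach_nsq_le:
  assumes "set L \<subseteq> Pn n" "reach \<nu> L x y"
  shows "nsq n y \<le> nsq n x"
  using assms
proof (induction L arbitrary: x)
  case (Cons p L)
  obtain i j where p: "p = (i,j)" by (cases p)
  then have ij: "i \<in> {1..n}" "j \<in> {1..n}" "i \<noteq> j" using Cons.prems(1) by (auto simp: Pn_def)
  obtain c s where cs: "c\<^sup>2 + (cmod s)\<^sup>2 = 1" and r: "reach \<nu> L (jact i j c s x) y"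
    using Cons.prems(2) p by auto
  have "nsq n y \<le> nsq n (jact i j c s x)" using Cons.IH[OF _ r] Cons.prems(1) by simp
  also have "\<dots> \<le> nsq n x" unfolding nsq_jact[OF ij cs, of x] by simp
  finally show ?case .
qed simp

text \<open>The norm never increases along a path, so if the end is as large as the start, no single
  step loses anything and every pivot block is zero when its turn comes.\<close>

lemma reach_iso_path:
  assumes "set L \<subseteq> Pn n" "0 < \<nu>" "reach \<nu> L x y" "nsq n x \<le> nsq n y"
  shows "iso_path L x y"
  using assms
proof (induction L arbitrary: x)
  case (Cons p L)
  obtain i j where p: "p = (i,j)" by (cases p)
  then have ij: "i \<in> {1..n}" "j \<in> {1..n}" "i \<noteq> j" using Cons.prems(1) by (auto simp: Pn_def)
  obtain c s where c: "\<nu> \<le> \<bar>c\<bar>" and cs: "c\<^sup>2 + (cmod s)\<^sup>2 = 1"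
    and r: "reach \<nu> L (jact i j c s x) y"
    using Cons.prems(3) p by auto
  have L: "set L \<subseteq> Pn n" using Cons.prems(1) by simp
  let ?d = "(cmod (x (i,i)))\<^sup>2 + (cmod (x (i,j)))\<^sup>2 + (cmod (x (j,i)))\<^sup>2 + (cmod (x (j,j)))\<^sup>2"
  have le: "nsq n y \<le> nsq n (jact i j c s x)" using reach_nsq_le[OF L r] .
  have eq: "nsq n x = nsq n (jact i j c s x) + ?d" by (rule nsq_jact[OF ij cs])
  have d: "?d \<le> 0" using le eq Cons.prems(4) by linarith
  have z: "x (i,i) = 0 \<and> x (i,j) = 0 \<and> x (j,i) = 0 \<and> x (j,j) = 0"
  proof -
    have "(cmod (x (i,i)))\<^sup>2 = 0 \<and> (cmod (x (i,j)))\<^sup>2 = 0 \<and> (cmod (x (j,i)))\<^sup>2 = 0 \<and> (cmod (x (j,j)))\<^sup>2 = 0"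
      using d zero_le_power2[of "cmod (x (i,i))"] zero_le_power2[of "cmod (x (i,j))"]
        zero_le_power2[of "cmod (x (j,i))"] zero_le_power2[of "cmod (x (j,j))"] by linarith
    then show ?thesis by simp
  qed
  have "c \<noteq> 0" using c Cons.prems(2) by auto
  then have "iso_step p x (jact i j c s x)" using z p ij cs by (auto simp: iso_step_def)
  moreover have "iso_path L (jact i j c s x) y"
    using Cons.IH[OF L Cons.prems(2) r] eq z Cons.prems(4) by simp
  ultimately show ?case by auto
qed simp

section \<open>Symmetries of lossless paths: time reversal, commutation, relabelling\<close>

lemma iso_step_reverse:
  assumes "iso_step p x y" shows "iso_step p y x"
proof -
  obtain i j where p: "p = (i,j)" by (cases p)
  with assms obtain c s where ij: "i \<noteq> j" and z: "x (i,i) = 0" "x (i,j) = 0" "x (j,i) = 0" "x (j,j) = 0"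
    and cs: "c \<noteq> 0" "c\<^sup>2 + (cmod s)\<^sup>2 = 1" and y: "y = jact i j c s x"
    by (auto simp: iso_step_def)
  \<comment> \<open>The step back is the rotation with -s; its own vanishing condition holds since
    \<open>jact\<close> has just deleted the pivot block.\<close>
  have "x = jact i j c (- s) y" using jact_inverse[of i j c s x] ij cs z y by simp
  moreover have "y (i,i) = 0 \<and> y (i,j) = 0 \<and> y (j,i) = 0 \<and> y (j,j) = 0" by (simp add: y jact_def)
  moreover have "c\<^sup>2 + (cmod (- s))\<^sup>2 = 1" using cs by simp
  ultimately show ?thesis unfolding p iso_step_def prod.case using ij cs(1) by blast
qed

lemma iso_path_reverse: "iso_path L x y \<Longrightarrow> iso_path (rev L) y x"
proof (induction L arbitrary: x)
  case (Cons p L)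
  then obtain z where z: "iso_step p x z" "iso_path (rev L) y z" by auto
  show ?case using iso_step_reverse[OF z(1)] z(2) by (auto simp: iso_path_append)
qed simp

lemma iso_step_swap: "iso_step (i,j) x y \<Longrightarrow> iso_step (j,i) x y"
  unfolding iso_step_def prod.case
  by (metis jact_swap complex_mod_cnj norm_minus_cancel)

lemma iso_step_commute:
  assumes "iso_step p x z" "iso_step p' z y" "{fst p, snd p} \<inter> {fst p', snd p'} = {}"
  shows "\<exists>z. iso_step p' x z \<and> iso_step p z y"
proof -
  obtain i j i' j' where p: "p = (i,j)" "p' = (i',j')" by (cases p, cases p')
  obtain c s where x: "i \<noteq> j" "x (i,i) = 0" "x (i,j) = 0" "x (j,i) = 0" "x (j,j) = 0"
    and cs: "c \<noteq> 0" "c\<^sup>2 + (cmod s)\<^sup>2 = 1" and eq1: "z = jact i j c s x"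
    using assms(1) unfolding p iso_step_def prod.case by blast
  obtain c' s' where z: "i' \<noteq> j'" "z (i',i') = 0" "z (i',j') = 0" "z (j',i') = 0" "z (j',j') = 0"
    and cs': "c' \<noteq> 0" "c'\<^sup>2 + (cmod s')\<^sup>2 = 1" and eq2: "y = jact i' j' c' s' z"
    using assms(2) unfolding p iso_step_def prod.case by blast
  have dj: "{i,j} \<inter> {i',j'} = {}" using assms(3) p by simp
  have ne: "i \<noteq> i'" "i' \<noteq> i" "i \<noteq> j'" "j' \<noteq> i" "j \<noteq> i'" "i' \<noteq> j" "j \<noteq> j'" "j' \<noteq> j"
    using dj by blast+
  \<comment> \<open>The intermediate state of the exchanged order. Neither rotation alters the pivot
    block of the other, so both vanishing conditions carry over.\<close>
  define w where "w = jact i' j' c' s' x"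
  have "y = jact i j c s w" unfolding w_def eq1 eq2 by (rule jact_commute[OF x(1) z(1) dj, symmetric])
  moreover have "w (i,i) = 0 \<and> w (i,j) = 0 \<and> w (j,i) = 0 \<and> w (j,j) = 0"
    using x ne by (simp add: w_def jact_def)
  moreover have "x (i',i') = 0 \<and> x (i',j') = 0 \<and> x (j',i') = 0 \<and> x (j',j') = 0"
    using z ne by (simp add: eq1 jact_def)
  ultimately have "iso_step p' x w \<and> iso_step p w y"
    unfolding iso_step_def p prod.case using x(1) z(1) cs cs' w_def by blast
  then show ?thesis by blast
qed

lemma iso_path_adm_transp:
  assumes "adm_transp Q Q'" "iso_path Q x y"
  shows "iso_path Q' x y"
proof -
  obtain xs p q ys where Q: "Q = xs @ [p, q] @ ys" "Q' = xs @ [q, p] @ ys"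
    and d: "{fst p, snd p} \<inter> {fst q, snd q} = {}"
    using assms(1) unfolding adm_transp_def by blast
  obtain a b c where "iso_path xs x a" "iso_step p a b" "iso_step q b c" "iso_path ys c y"
    using assms(2) unfolding Q(1) iso_path_append by auto
  moreover from this obtain b' where "iso_step q a b'" "iso_step p b' c"
    using iso_step_commute[OF _ _ d] by blast
  ultimately show ?thesis unfolding Q(2) iso_path_append by auto
qed

lemma iso_path_ord_equiv:
  assumes "ord_equiv Q Q'" "iso_path Q x y"
  shows "iso_path Q' x y"
  using assms(1)[unfolded ord_equiv_def] assms(2)
  by (induction rule: rtranclp_induct) (auto intro: iso_path_adm_transp)

lemma iso_step_relabel:
  assumes "inj q" "iso_step (q i, q j) x y"
  shows "iso_step (i, j) (\<lambda>(k,l). x (q k, q l)) (\<lambda>(k,l). y (q k, q l))"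
proof -
  obtain c s where cs: "c \<noteq> 0" "c\<^sup>2 + (cmod s)\<^sup>2 = 1" "y = jact (q i) (q j) c s x"
    using assms(2) by (auto simp: iso_step_def)
  then have "(\<lambda>(k,l). y (q k, q l)) = jact i j c s (\<lambda>(k,l). x (q k, q l))"
    using jact_relabel[OF assms(1)] by (simp add: fun_eq_iff)
  then show ?thesis using assms(2) cs(1,2) unfolding iso_step_def by auto
qed

lemma iso_path_relabel:
  assumes "inj q" "iso_path (map (\<lambda>(i,j). (min (q i) (q j), max (q i) (q j))) L) x y"
  shows "iso_path L (\<lambda>(k,l). x (q k, q l)) (\<lambda>(k,l). y (q k, q l))"
  using assms(2)
proof (induction L arbitrary: x)
  case (Cons p L)
  obtain i j where p: "p = (i,j)" by (cases p)
  from Cons.prems obtain z where st: "iso_step (min (q i) (q j), max (q i) (q j)) x z"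
    and "iso_path (map (\<lambda>(i,j). (min (q i) (q j), max (q i) (q j))) L) z y"
    by (auto simp: p)
  \<comment> \<open>Sorting may have put \<open>q j\<close> before \<open>q i\<close>; a lossless
    step can be read in either orientation.\<close>
  moreover have "iso_step (q i, q j) x z"
    using st iso_step_swap[of "q j" "q i" x z] by (cases "q i \<le> q j") (simp_all add: min_def max_def)
  ultimately show ?case
    using Cons.IH[of z] iso_step_relabel[OF assms(1), of i j x z] p by auto
qed simp

section \<open>Serial orderings admit no lossless path\<close>

definition zero_on :: "nat set \<Rightarrow> (nat \<times> nat \<Rightarrow> complex) \<Rightarrow> bool" where
  "zero_on B x \<longleftrightarrow> (\<forall>k\<in>B. \<forall>l\<in>B. x (k,l) = 0)"

text \<open>When both pivot indices lie in \<open>B\<close>, each new entry of the B x B block is a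
  linear combination of old entries of that block.\<close>

lemma iso_path_zero_on:
  assumes "set L \<subseteq> B \<times> B" "iso_path L x y" "zero_on B x"
  shows "zero_on B y"
  using assms
proof (induction L arbitrary: x)
  case (Cons p L)
  obtain i j where p: "p = (i,j)" by (cases p)
  with Cons.prems obtain z where z: "iso_step (i,j) x z" "iso_path L z y" by auto
  have "i \<in> B" "j \<in> B" using Cons.prems(1) p by auto
  moreover have "x (k,l) = 0" if "k \<in> B" "l \<in> B" for k l using Cons.prems(3) that by (simp add: zero_on_def)
  moreover obtain c s where "z = jact i j c s x" using z(1) by (auto simp: iso_step_def)
  ultimately have "zero_on B z" by (simp add: zero_on_def jact_def)
  with Cons.IH[of z] Cons.prems(1) z(2) show ?case by simp
qed simp

lemma iso_path_zero_on_start: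
  assumes "set L \<subseteq> B \<times> B" "iso_path L x y" "zero_on B y"
  shows "zero_on B x"
  using iso_path_zero_on[of "rev L" B y x] iso_path_reverse[OF assms(2)] assms(1,3) by simp

text \<open>
  A rotation in the plane $(p,m)$ moves the entries $(k,m)$, $(m,k)$ only into row and column $p$,
  which is not a pivot again; the entries themselves are merely scaled by the cosine, since
  $(k,p)$ and $(p,k)$ vanish.
\<close>

lemma iso_path_star:
  assumes "iso_path (map (\<lambda>k. (k,m)) ks) x y" "distinct ks" "m \<notin> set ks" "zero_on (set ks) x"
    "k \<in> set ks"
  shows "x (k,m) = 0 \<and> x (m,k) = 0"
  using assms
proof (induction ks arbitrary: x)
  case (Cons p ks)
  from Cons.prems(1) obtain z where z: "iso_step (p,m) x z" "iso_path (map (\<lambda>k. (k,m)) ks) z y" by auto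
  then obtain c s where c: "c \<noteq> 0" and eq: "z = jact p m c s x" by (auto simp: iso_step_def)
  show ?case
  proof (cases "k = p")
    case True
    then show ?thesis using z by (auto simp: iso_step_def)
  next
    case False
    then have k: "k \<in> set ks" using Cons.prems by simp
    have "z (k,l) = x (k,l)" if "k \<in> set ks" "l \<in> set ks" for k l
      using Cons.prems(2,3) that by (auto simp: eq jact_def)
    then have "zero_on (set ks) z" using Cons.prems(4) by (simp add: zero_on_def)
    then have "z (k,m) = 0 \<and> z (m,k) = 0" using Cons.IH[OF z(2)] Cons.prems k by auto
    moreover have "x (k,p) = 0" "x (p,k) = 0" using Cons.prems(4) k by (auto simp: zero_on_def)
    moreover have "k \<noteq> m" "m \<noteq> k" "p \<noteq> m" "m \<noteq> p" using k Cons.prems(3) by auto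
    ultimately show ?thesis using False c by (simp add: eq jact_def)
  qed
qed simp

text \<open>The induction step for serial orderings: a full column over a zero block enlarges the
  block by the index \<open>m\<close>.\<close>

lemma iso_path_star_zero_on:
  assumes "iso_path (map (\<lambda>k. (k,m)) ks) x y" "distinct ks" "ks \<noteq> []" "m \<notin> set ks" "zero_on (set ks) x"
  shows "zero_on (insert m (set ks)) y"
proof -
  \<comment> \<open>The diagonal entry at \<open>m\<close> belongs to the first pivot block of the
    star.\<close>
  have "x (m,m) = 0" using assms(1,3) by (cases ks) (auto simp: iso_step_def)
  then have "zero_on (insert m (set ks)) x"
    using iso_path_star[OF assms(1,2,4,5)] assms(5) by (auto simp: zero_on_def)
  then show ?thesis by (intro iso_path_zero_on[OF _ assms(1)]) auto
qed

text \<open>Turns a row of pairs into a star with second index \<open>m\<close>, so that rows are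
  treated like columns.\<close>

lemma iso_path_swap:
  "iso_path (map (\<lambda>k. (m, f k)) ks) x y \<Longrightarrow> iso_path (map (\<lambda>k. (k,m)) (map f ks)) x y"
proof (induction ks arbitrary: x)
  case (Cons k ks)
  then obtain z where z: "iso_step (m, f k) x z" "iso_path (map (\<lambda>k. (k,m)) (map f ks)) z y" by auto
  show ?case using iso_step_swap[OF z(1)] z(2) by auto
qed simp

text \<open>Induction over the columns: after those with index up to m the block {1..m} is zero, and
  column m+1 is a star over this block.\<close>

lemma iso_path_columns:
  assumes "\<forall>j\<in>{2..n}. \<tau> j permutes {1..j-1}" "n \<ge> 2"
    "iso_path (concat (map (\<lambda>j. map (\<lambda>k. (\<tau> j k, j)) [1..<j]) [2..<n+1])) x y"
  shows "zero_on {1..n} y"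
  using assms(2,1,3)
proof (induction n arbitrary: y rule: dec_induct)
  case base
  \<comment> \<open>The first column is the single pair (1,2), as a permutation of {1} fixes
    1.\<close>
  have "\<tau> 2 permutes {1..2-1}" using base.prems(1) by (rule bspec) simp
  then have "\<tau> 2 1 = 1" using permutes_in_image[of "\<tau> 2" "{1..2-1}" 1] by simp
  then have "iso_path (map (\<lambda>k. (k,2)) [1]) x y" using base.prems by (simp add: upt_rec)
  moreover from this have "zero_on (set [1]) x" by (auto simp: zero_on_def iso_step_def)
  ultimately have "zero_on (insert 2 (set [1])) y" by (intro iso_path_star_zero_on) auto
  moreover have "insert 2 (set [1]) = {1..2::nat}" by auto
  ultimately show ?case by simp
next
  case (step m)
  let ?ks = "map (\<tau> (Suc m)) [1..<Suc m]"
  have p: "\<tau> (Suc m) permutes {1..m}"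
    using bspec[OF step.prems(1), of "Suc m"] step.hyps by simp
  have up: "[2..<Suc m + 1] = [2..<m+1] @ [Suc m]" using step.hyps by simp
  obtain z where z: "iso_path (concat (map (\<lambda>j. map (\<lambda>k. (\<tau> j k, j)) [1..<j]) [2..<m+1])) x z"
    and "iso_path (map (\<lambda>k. (\<tau> (Suc m) k, Suc m)) [1..<Suc m]) z y"
    using step.prems(2) unfolding up map_append concat_append iso_path_append by auto
  then have s: "iso_path (map (\<lambda>k. (k, Suc m)) ?ks) z y" by (simp add: comp_def del: upt_Suc)
  have set: "set ?ks = {1..m}" using permutes_image[OF p] by (auto simp del: upt_Suc simp: atLeastLessThanSuc_atLeastAtMost)
  have "distinct ?ks" using p by (simp add: distinct_map permutes_inj_on del: upt_Suc)
  moreover have "zero_on {1..m} z" using step.IH[OF _ z] step.prems(1) by auto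
  ultimately have "zero_on (insert (Suc m) {1..m}) y"
    using iso_path_star_zero_on[OF s] step.hyps unfolding set by (simp del: upt_Suc)
  moreover have "insert (Suc m) {1..m} = {1..Suc m}" by auto
  ultimately show ?case by simp
qed

text \<open>Mirror image of the column case: \<open>n\<close> is fixed and the zero block {i..n}
  grows as \<open>i\<close> decreases. The induction variable \<open>d\<close> counts the rows of
  pairs processed before row \<open>i\<close>.\<close>

lemma iso_path_rows:
  assumes "\<forall>i\<in>{1..n-1}. \<tau> i permutes {i+1..n}" "1 \<le> i" "i + Suc d = n"
    "iso_path (concat (map (\<lambda>i. map (\<lambda>k. (i, \<tau> i k)) [i+1..<n+1]) (rev [i..<n]))) x y"
  shows "zero_on {i..n} y"
  using assms(2-)
proof (induction d arbitrary: i y)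
  case 0
  then have n: "n = Suc i" by simp
  have p: "\<tau> i permutes {n}"
    using bspec[OF assms(1), of i] 0 by (simp add: n)
  then have "\<tau> i n = n" using permutes_in_image[OF p, of n] by simp
  then have s: "iso_path (map (\<lambda>k. (k,i)) [n]) x y"
    using iso_path_swap[of i "\<tau> i" "[n]" x y] 0 by (simp add: n)
  moreover have "zero_on (set [n]) x" using s by (auto simp: zero_on_def iso_step_def)
  ultimately have "zero_on (insert i (set [n])) y" by (intro iso_path_star_zero_on) (auto simp: n)
  moreover have "insert i (set [n]) = {i..n}" by (auto simp: n)
  ultimately show ?case by simp
next
  case (Suc d)
  let ?ks = "map (\<tau> i) [i+1..<n+1]"
  have p: "\<tau> i permutes {i+1..n}" using bspec[OF assms(1), of i] Suc.prems(1,2) by simp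
  have up: "rev [i..<n] = rev [i+1..<n] @ [i]" using Suc.prems(2) by (simp add: upt_conv_Cons)
  obtain z where z: "iso_path (concat (map (\<lambda>i. map (\<lambda>k. (i, \<tau> i k)) [i+1..<n+1]) (rev [i+1..<n]))) x z"
    and "iso_path (map (\<lambda>k. (i, \<tau> i k)) [i+1..<n+1]) z y"
    using Suc.prems(3) unfolding up map_append concat_append iso_path_append by auto
  then have s: "iso_path (map (\<lambda>k. (k,i)) ?ks) z y" by (intro iso_path_swap)
  have set: "set ?ks = {i+1..n}"
    using permutes_image[OF p] by (auto simp del: upt_Suc simp: atLeastLessThanSuc_atLeastAtMost)
  have "distinct ?ks" using p by (simp add: distinct_map permutes_inj_on del: upt_Suc)
  moreover have "zero_on {i+1..n} z" using Suc.IH[OF _ _ z] Suc.prems(2) by simp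
  ultimately have "zero_on (insert i {i+1..n}) y"
    using iso_path_star_zero_on[OF s] Suc.prems(2) unfolding set by (simp del: upt_Suc)
  moreover have "insert i {i+1..n} = {i..n}" using Suc.prems(2) by auto
  ultimately show ?case by simp
qed

lemma iso_path_Cc_Cr:
  assumes "Q \<in> Cc n \<union> Cr n" "n \<ge> 2" "iso_path Q x y"
  shows "zero_on {1..n} y"
proof (cases "Q \<in> Cc n")
  case True
  then show ?thesis using iso_path_columns[OF _ assms(2)] assms(3) unfolding Cc_def by blast
next
  case False
  then obtain \<tau> where "\<forall>i\<in>{1..n-1}. \<tau> i permutes {i+1..n}"
    "Q = concat (map (\<lambda>i. map (\<lambda>k. (i, \<tau> i k)) [i+1..<n+1]) (rev [1..<n]))"
    using assms(1) unfolding Cr_def by blast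
  then show ?thesis using iso_path_rows[of n \<tau> 1 "n - 2" x y] assms(2,3) by simp
qed

section \<open>Transfer along equivalences of orderings\<close>

definition sweeps :: "nat \<Rightarrow> (nat \<times> nat) list \<Rightarrow> (nat \<times> nat) list" where
  "sweeps m Q = concat (replicate m Q)"

text \<open>It is the starting state that has to vanish, because the contraction argument compares
  norms with that of the start.\<close>

definition no_iso :: "nat \<Rightarrow> (nat \<times> nat) list \<Rightarrow> bool" where
  "no_iso n L \<longleftrightarrow> (\<forall>x y. iso_path L x y \<longrightarrow> zero_on {1..n} x)"

lemma Pn_subset: "Pn n \<subseteq> {1..n} \<times> {1..n}"
  by (auto simp: Pn_def)

lemma set_sweeps: "is_ordering n Q \<Longrightarrow> set (sweeps m Q) \<subseteq> Pn n"
  by (auto simp: sweeps_def is_ordering_def)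

lemma no_iso_Csp:
  assumes "Q \<in> Csp n" "n \<ge> 2" "is_ordering n Q"
  shows "no_iso n Q"
  unfolding no_iso_def
proof (intro allI impI)
  fix x y assume path: "iso_path Q x y"
  have sub: "set Q \<subseteq> {1..n} \<times> {1..n}"
    using assms(3) Pn_subset by (simp add: is_ordering_def)
  show "zero_on {1..n} x"
  proof (cases "Q \<in> Cc n \<union> Cr n")
    case True
    \<comment> \<open>The end of the path is zero, and \<open>iso_path_zero_on_start\<close> carries
      this to its start.\<close>
    then show ?thesis using iso_path_zero_on_start[OF sub path] iso_path_Cc_Cr[OF _ assms(2) path] by simp
  next
    case False
    then have "rev Q \<in> Cc n \<union> Cr n" using assms(1) by (auto simp: Csp_def)
    \<comment> \<open>For a reversed ordering, the reversed path ends at \<open>x\<close>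
      itself.\<close>
    then show ?thesis using iso_path_Cc_Cr[OF _ assms(2) iso_path_reverse[OF path]] by simp
  qed
qed

lemma iso_path_sweeps_ord_equiv:
  assumes "ord_equiv Q Q'" "iso_path (sweeps m Q) x y"
  shows "iso_path (sweeps m Q') x y"
  using assms(2)
proof (induction m arbitrary: x)
  case (Suc m)
  then obtain z where "iso_path Q x z" "iso_path (sweeps m Q) z y"
    by (auto simp: sweeps_def iso_path_append)
  then show ?case
    using iso_path_ord_equiv[OF assms(1)] Suc.IH by (auto simp: sweeps_def iso_path_append)
qed (simp add: sweeps_def)

lemma sweeps_shift: "sweeps (Suc m) (L1 @ L2) = L1 @ sweeps m (L2 @ L1) @ L2"
  by (induction m) (simp_all add: sweeps_def)

text \<open>One extra sweep pays for the shift: by \<open>sweeps_shift\<close> the state after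
  \<open>L1\<close> starts a lossless path through \<open>m\<close> sweeps of the shifted ordering
  and so is zero, and this is carried back along \<open>L1\<close>.\<close>

lemma no_iso_shift_equiv:
  assumes "shift_equiv Q Q'" "is_ordering n Q" "no_iso n (sweeps m Q')"
  shows "no_iso n (sweeps (Suc m) Q)"
  unfolding no_iso_def
proof (intro allI impI)
  fix x y assume path: "iso_path (sweeps (Suc m) Q) x y"
  obtain L1 L2 where Q: "Q = L1 @ L2" "Q' = L2 @ L1" using assms(1) by (auto simp: shift_equiv_def)
  from path obtain z w where z: "iso_path L1 x z" "iso_path (sweeps m Q') z w"
    unfolding Q sweeps_shift iso_path_append by blast
  have "set L1 \<subseteq> {1..n} \<times> {1..n}"
    using assms(2) Pn_subset[of n] unfolding is_ordering_def Q by auto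
  then show "zero_on {1..n} x"
    using iso_path_zero_on_start[OF _ z(1)] assms(3) z(2) unfolding no_iso_def by blast
qed

text \<open>Induction from the front of the chain: a shift costs one additional sweep, an
  equivalence costs none.\<close>

lemma no_iso_chain:
  assumes "length chain = length rels + 1" "\<forall>c \<in> set chain. is_ordering n c"
    "\<forall>k < length rels. if rels ! k then shift_equiv (chain ! k) (chain ! Suc k)
                                     else ord_equiv (chain ! k) (chain ! Suc k)"
    "no_iso n (chain ! length rels)"
  shows "no_iso n (sweeps (length (filter id rels) + 1) (chain ! 0))"
  using assms
proof (induction rels arbitrary: chain)
  case Nil
  then show ?case by (simp add: sweeps_def)
next
  case (Cons r rels)
  then obtain c cs where chain: "chain = c # cs" by (cases chain) auto
  have IH: "no_iso n (sweeps (length (filter id rels) + 1) (cs ! 0))"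
  proof (rule Cons.IH)
    show "\<forall>k < length rels. if rels ! k then shift_equiv (cs ! k) (cs ! Suc k)
                                     else ord_equiv (cs ! k) (cs ! Suc k)"
    proof (intro allI impI)
      fix k assume "k < length rels"
      then show "if rels ! k then shift_equiv (cs ! k) (cs ! Suc k) else ord_equiv (cs ! k) (cs ! Suc k)"
        using Cons.prems(3)[rule_format, of "Suc k"] by (simp add: chain split: if_splits)
    qed
  qed (use Cons.prems in \<open>simp_all add: chain\<close>)
  have r: "if r then shift_equiv c (cs ! 0) else ord_equiv c (cs ! 0)"
    using Cons.prems(3)[rule_format, of 0] by (simp add: chain split: if_splits)
  show ?case
  proof (cases r)
    case True
    then show ?thesis using no_iso_shift_equiv[OF _ _ IH] r Cons.prems(2) by (simp add: chain id_def)
  next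
    case False
    then show ?thesis
      using r IH iso_path_sweeps_ord_equiv[of c "cs ! 0"] unfolding no_iso_def by (simp add: chain id_def) blast
  qed
qed

lemma no_iso_weak_equiv:
  assumes "weak_equiv_canon n Q Q' d" "no_iso n Q'"
  shows "no_iso n (sweeps (d + 1) Q)"
  using assms no_iso_chain unfolding weak_equiv_canon_def by blast

lemma weak_equiv_canon_ordering:
  assumes "weak_equiv_canon n Q Q' d" shows "is_ordering n Q" "is_ordering n Q'"
  using assms unfolding weak_equiv_canon_def by (metis nth_mem less_add_one add_gr_0 less_one)+

lemma no_iso_perm_equiv:
  assumes "perm_equiv n Q Q'" "no_iso n (sweeps m Q')"
  shows "no_iso n (sweeps m Q)"
  unfolding no_iso_def
proof (intro allI impI)
  fix x y assume path: "iso_path (sweeps m Q) x y"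
  let ?f = "\<lambda>q :: nat \<Rightarrow> nat. \<lambda>(i,j). (min (q i) (q j), max (q i) (q j))"
  obtain q where q: "q permutes {1..n}" and Q': "Q' = map (?f q) Q"
    using assms(1) unfolding perm_equiv_def by blast
  \<comment> \<open>\<open>Q\<close> is recovered from \<open>Q'\<close> by the inverse
    relabelling.\<close>
  define r where "r = inv_into UNIV q"
  have r: "inj r" "\<And>k. r (q k) = k"
    using permutes_inj[OF permutes_inv[OF q]] permutes_inverses[OF q] by (auto simp: r_def)
  \<comment> \<open>Sorting after each relabelling is harmless, because every pair of an ordering is
    increasing.\<close>
  have "?f r (?f q p) = p" if "p \<in> set Q" for p
  proof -
    obtain i j where p: "p = (i,j)" by (cases p)
    have "i < j" using that assms(1) p by (auto simp: perm_equiv_def is_ordering_def Pn_def)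
    then show ?thesis by (cases "q i \<le> q j") (simp_all add: p r)
  qed
  then have "Q = map (?f r) Q'" by (simp add: Q' map_idI)
  then have "sweeps m Q = map (?f r) (sweeps m Q')"
    by (simp add: sweeps_def map_concat)
  then have "iso_path (sweeps m Q') (\<lambda>(k,l). x (r k, r l)) (\<lambda>(k,l). y (r k, r l))"
    using iso_path_relabel[OF r(1)] path by simp
  then have z: "zero_on {1..n} (\<lambda>(k,l). x (r k, r l))"
    using assms(2) unfolding no_iso_def by blast
  show "zero_on {1..n} x"
    unfolding zero_on_def
  proof (intro ballI)
    fix k l assume "k \<in> {1..n}" "l \<in> {1..n}"
    then have "q k \<in> {1..n}" "q l \<in> {1..n}" using permutes_in_image[OF q] by blast+
    then have "(\<lambda>(k,l). x (r k, r l)) (q k, q l) = 0" using z unfolding zero_on_def by blast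
    then show "x (k,l) = 0" by (simp add: r)
  qed
qed

lemma no_iso_generalized_serial:
  assumes "n \<ge> 2" "Q'' \<in> Csp n"
    "(perm_equiv n Q Q' \<and> weak_equiv_canon n Q' Q'' d) \<or>
     (weak_equiv_canon n Q Q' d \<and> perm_equiv n Q' Q'')"
  shows "is_ordering n Q" "no_iso n (sweeps (d + 1) Q)"
proof -
  show "is_ordering n Q" using assms(3) weak_equiv_canon_ordering by (auto simp: perm_equiv_def)
  have "is_ordering n Q''" using assms(3) weak_equiv_canon_ordering by (auto simp: perm_equiv_def)
  then have "no_iso n Q''" using no_iso_Csp assms(1,2) by blast
  then show "no_iso n (sweeps (d + 1) Q)"
    using assms(3)
  proof (elim disjE conjE)
    assume "perm_equiv n Q Q'" "weak_equiv_canon n Q' Q'' d"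
    then show ?thesis using \<open>no_iso n Q''\<close> no_iso_weak_equiv no_iso_perm_equiv by blast
  next
    assume w: "weak_equiv_canon n Q Q' d" and p: "perm_equiv n Q' Q''"
    \<comment> \<open>Here the relabelling comes after the chain, so it is applied to a single
      sweep.\<close>
    have "no_iso n Q'" using no_iso_perm_equiv[OF p, of 1] \<open>no_iso n Q''\<close> by (simp add: sweeps_def)
    then show ?thesis by (rule no_iso_weak_equiv[OF w])
  qed
qed

section \<open>Uniform contraction by compactness\<close>

lemma compact_jact_params:
  "compact {z :: real \<times> complex. \<nu> \<le> \<bar>fst z\<bar> \<and> (fst z)\<^sup>2 + (cmod (snd z))\<^sup>2 = 1}" (is "compact ?K")
proof -
  have closed: "closed ?K"
    by (intro closed_Collect_conj closed_Collect_le closed_Collect_eq continuous_intros)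
  have sub: "?K \<subseteq> cball 0 1 \<times> cball 0 1"
  proof
    fix z :: "real \<times> complex" assume "z \<in> ?K"
    then have eq: "(fst z)\<^sup>2 + (cmod (snd z))\<^sup>2 = 1" by simp
    have "(fst z)\<^sup>2 \<le> 1" using eq zero_le_power2[of "cmod (snd z)"] by linarith
    then have "\<bar>fst z\<bar> \<le> 1" by (simp only: abs_square_le_1)
    moreover have "(cmod (snd z))\<^sup>2 \<le> 1\<^sup>2"
      using eq zero_le_power2[of "fst z"] unfolding one_power2 by linarith
    then have "cmod (snd z) \<le> 1" by (rule power2_le_imp_le) simp
    ultimately show "z \<in> cball 0 1 \<times> cball 0 1" by (cases z) simp
  qed
  have "compact (cball 0 1 \<times> cball 0 1 :: (real \<times> complex) set)"
    by (intro compact_Times compact_cball)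
  from compact_Int_closed[OF this closed] show ?thesis using sub by (simp only: Int_absorb1)
qed

text \<open>The topology on states is that of pointwise convergence. Which case of
  \<open>jact\<close> applies depends only on the position, and each case is a polynomial in c, s,
  cnj s and entries of the state.\<close>

lemma continuous_on_jact:
  "continuous_on A (\<lambda>(x, c, s). jact i j c s x)"
proof (rule continuous_on_coordinatewise_then_product)
  fix p :: "nat \<times> nat"
  obtain k l where p: "p = (k,l)" by (cases p)
  have f: "continuous_on A (\<lambda>z :: (nat \<times> nat \<Rightarrow> complex) \<times> real \<times> complex. fst z u)" for u
    by (rule continuous_on_product_then_coordinatewise[OF continuous_on_fst[OF continuous_on_id]])
  have if_const: "continuous_on A (\<lambda>z. if P then g z else h z)"
    if "continuous_on A g" "continuous_on A h"
    for P and g h :: "(nat \<times> nat \<Rightarrow> complex) \<times> real \<times> complex \<Rightarrow> complex"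
    using that by (cases P) simp_all
  show "continuous_on A (\<lambda>z. (case z of (x, c, s) \<Rightarrow> jact i j c s x) p)"
    unfolding p jact_def case_prod_beta fst_conv snd_conv
    by (intro if_const continuous_intros f)
qed

text \<open>Each step is a continuous image of the product of a compact set of states with the
  compact parameter set.\<close>

lemma compact_reach:
  assumes "compact K"
  shows "compact {y. \<exists>x\<in>K. reach \<nu> L x y}"
  using assms
proof (induction L arbitrary: K)
  case Nil
  then show ?case by simp
next
  case (Cons p L)
  let ?P = "{z :: real \<times> complex. \<nu> \<le> \<bar>fst z\<bar> \<and> (fst z)\<^sup>2 + (cmod (snd z))\<^sup>2 = 1}"
  let ?K = "(\<lambda>(x, c, s). jact (fst p) (snd p) c s x) ` (K \<times> ?P)"
  have "compact ?K"
    by (intro compact_continuous_image continuous_on_jact compact_Times Cons.prems compact_jact_params)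
  from Cons.IH[OF this] show ?case
    by (rule back_subst[of compact]) force
qed

lemma continuous_on_nsq: "continuous_on A (nsq n)"
proof -
  have f: "continuous_on A (\<lambda>x :: nat \<times> nat \<Rightarrow> complex. x u)" for u
    by (rule continuous_on_product_then_coordinatewise[OF continuous_on_id])
  show ?thesis unfolding nsq_def[abs_def] by (intro continuous_intros f)
qed

lemma nsq_entry_le:
  assumes "k \<in> {1..n}" "l \<in> {1..n}"
  shows "(cmod (x (k,l)))\<^sup>2 \<le> nsq n x"
proof -
  have "(cmod (x (k,l)))\<^sup>2 \<le> (\<Sum>l\<in>{1..n}. (cmod (x (k,l)))\<^sup>2)"
    using assms by (intro member_le_sum) auto
  also have "\<dots> \<le> nsq n x"
    unfolding nsq_def using assms by (intro member_le_sum[where f = "\<lambda>k. \<Sum>l\<in>{1..n}. (cmod (x (k,l)))\<^sup>2"] sum_nonneg) auto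
  finally show ?thesis .
qed

text \<open>A finite-dimensional unit ball placed among functions on all of nat x nat; vanishing
  outside the block makes it compact in the product topology.\<close>

definition unit_states :: "nat \<Rightarrow> (nat \<times> nat \<Rightarrow> complex) set" where
  "unit_states n = {x. (\<forall>p. p \<notin> {1..n} \<times> {1..n} \<longrightarrow> x p = 0) \<and> nsq n x \<le> 1}"

text \<open>A closed subset of a Tychonoff product with unit discs as factors inside the block and
  the point 0 outside it.\<close>

lemma compact_unit_states: "compact (unit_states n)"
proof -
  let ?B = "\<lambda>p. if p \<in> {1..n} \<times> {1..n} then cball (0::complex) 1 else {0}"
  let ?P = "PiE UNIV ?B"
  have "compactin (product_topology (\<lambda>p::nat \<times> nat. euclidean) UNIV) ?P"
    unfolding compactin_PiE by auto
  then have P: "compact ?P" by (simp add: euclidean_product_topology)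
  have "closed {x. nsq n x \<le> 1}"
    by (intro closed_Collect_le continuous_on_nsq continuous_on_const)
  with P have "compact (?P \<inter> {x. nsq n x \<le> 1})" by (rule compact_Int_closed)
  moreover have "?P \<inter> {x. nsq n x \<le> 1} = unit_states n"
  proof -
    have "x \<in> ?P" if x: "x \<in> unit_states n" for x
    proof -
      have "x p \<in> ?B p" for p
      proof (cases "p \<in> {1..n} \<times> {1..n}")
        case True
        then obtain k l where p: "p = (k,l)" "k \<in> {1..n}" "l \<in> {1..n}" by auto
        have "(cmod (x p))\<^sup>2 \<le> 1\<^sup>2"
          using nsq_entry_le[OF p(2,3), of x] x by (simp add: unit_states_def p(1))
        then have "cmod (x p) \<le> 1" by (rule power2_le_imp_le) simp
        then show ?thesis using True by simp
      next
        case False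
        moreover from this have "x p = 0" using x unfolding unit_states_def by blast
        ultimately show ?thesis by (simp only: if_False singletonI)
      qed
      then show ?thesis by (simp add: PiE_UNIV_domain)
    qed
    moreover have "x p = 0" if "x \<in> ?P" "p \<notin> {1..n} \<times> {1..n}" for x p
    proof -
      have "x p \<in> ?B p" using that(1) by (rule PiE_mem) simp
      then show ?thesis using that(2) by (simp only: if_False singleton_iff)
    qed
    ultimately show ?thesis unfolding unit_states_def by blast
  qed
  ultimately show ?thesis by simp
qed

text \<open>Compactness turns strict loss for each state into uniform loss: the largest norm reached
  is attained, and if it were 1, the path would be lossless and its start zero.\<close>

lemma reach_contraction:
  assumes "set L \<subseteq> Pn n" "0 < \<nu>" "no_iso n L"
  shows "\<exists>\<zeta>. 0 \<le> \<zeta> \<and> \<zeta> < 1 \<and> (\<forall>x\<in>unit_states n. \<forall>y. reach \<nu> L x y \<longrightarrow> nsq n y \<le> \<zeta>)"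
proof -
  let ?S = "{y. \<exists>x\<in>unit_states n. reach \<nu> L x y}"
  have lt: "nsq n y < 1" if y: "y \<in> ?S" for y
  proof (rule ccontr)
    assume "\<not> nsq n y < 1"
    moreover obtain x where x: "x \<in> unit_states n" "reach \<nu> L x y" using y by blast
    ultimately have "nsq n x \<le> nsq n y" by (simp add: unit_states_def)
    then have "zero_on {1..n} x"
      using reach_iso_path[OF assms(1,2) x(2)] assms(3) unfolding no_iso_def by blast
    then have "nsq n x = 0" by (simp add: nsq_def zero_on_def)
    then show False using reach_nsq_le[OF assms(1) x(2)] \<open>\<not> nsq n y < 1\<close> by simp
  qed
  show ?thesis
  proof (cases "?S = {}")
    case True
    \<comment> \<open>There may be no reachable state at all, for instance when \<nu> > 1 and
      \<open>L\<close> is nonempty; then 0 serves as bound.\<close>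
    then show ?thesis by (intro exI[of _ 0]) auto
  next
    case False
    obtain y where y: "y \<in> ?S" "\<And>z. z \<in> ?S \<Longrightarrow> nsq n z \<le> nsq n y"
      using continuous_attains_sup[OF compact_reach[OF compact_unit_states] False continuous_on_nsq] by blast
    have "0 \<le> nsq n y" unfolding nsq_def by (intro sum_nonneg) auto
    then show ?thesis using lt[OF y(1)] y(2) by (intro exI[of _ "nsq n y"]) blast
  qed
qed

section \<open>Matrices and states\<close>

definition ve_index :: "nat \<Rightarrow> (nat \<times> nat) list" where
  "ve_index n = concat (map (\<lambda>t. map (\<lambda>s. (s,t)) [1..<t]) [2..<n+1]) @
     concat (map (\<lambda>s. map (\<lambda>t. (s,t)) [1..<s]) [2..<n+1])"

definition ve_state :: "nat \<Rightarrow> (nat \<times> nat \<Rightarrow> complex) \<Rightarrow> complex Matrix.vec" where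
  "ve_state n x = vec_of_list (map x (ve_index n))"

lemma ve_eq: "ve n A = ve_state n (\<lambda>(s,t). A $$ (s - 1, t - 1))"
  by (simp add: ve_def ve_state_def ve_index_def map_concat comp_def del: upt_Suc)

lemma set_ve_index: "set (ve_index n) = {(s,t). s \<in> {1..n} \<and> t \<in> {1..n} \<and> s \<noteq> t}"
proof -
  have "(s,t) \<in> set (ve_index n) \<longleftrightarrow>
      (2 \<le> t \<and> t \<le> n \<and> 1 \<le> s \<and> s < t) \<or> (2 \<le> s \<and> s \<le> n \<and> 1 \<le> t \<and> t < s)" for s t
  proof -
    have "(s,t) \<in> (\<Union>t\<in>A. (\<lambda>s. (s,t)) ` B t) \<longleftrightarrow> t \<in> A \<and> s \<in> B t"
      "(s,t) \<in> (\<Union>s\<in>A. (\<lambda>t. (s,t)) ` B s) \<longleftrightarrow> s \<in> A \<and> t \<in> B s" for A :: "nat set" and B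
      by blast+
    then show ?thesis
      unfolding ve_index_def set_append set_concat set_map set_upt image_image Un_iff by auto
  qed
  then have "(s,t) \<in> set (ve_index n) \<longleftrightarrow> s \<in> {1..n} \<and> t \<in> {1..n} \<and> s \<noteq> t" for s t
    unfolding atLeastAtMost_iff by presburger
  then show ?thesis by auto
qed

lemma distinct_concat_map:
  assumes "distinct xs" "\<And>x. x \<in> set xs \<Longrightarrow> distinct (f x)"
    "\<And>x y. x \<in> set xs \<Longrightarrow> y \<in> set xs \<Longrightarrow> x \<noteq> y \<Longrightarrow> set (f x) \<inter> set (f y) = {}"
  shows "distinct (concat (map f xs))"
  using assms
proof (induction xs)
  case (Cons a xs)
  have "set (f a) \<inter> set (f y) = {}" if "y \<in> set xs" for y
    using Cons.prems(1) Cons.prems(3)[of a y] that by auto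
  then show ?case using Cons by auto
qed simp

lemma distinct_ve_index: "distinct (ve_index n)"
  unfolding ve_index_def distinct_append
  by (intro conjI distinct_concat_map) (auto simp: distinct_map inj_on_def simp del: upt_Suc)

lemma length_ve_index: "length (ve_index n) = twoN n"
proof -
  have "set (ve_index n) = {1..n} \<times> {1..n} - (\<lambda>k. (k,k)) ` {1..n}"
    unfolding set_ve_index by auto
  moreover have "card ((\<lambda>k. (k,k)) ` {1..n}) = n"
    by (subst card_image) (auto simp: inj_on_def)
  moreover have "card ({1..n} \<times> {1..n} - (\<lambda>k. (k,k)) ` {1..n})
      = card ({1..n} \<times> {1..n}) - card ((\<lambda>k. (k,k)) ` {1..n})"
    by (rule card_Diff_subset) auto
  ultimately have "card (set (ve_index n)) = n * n - n" by (simp add: card_cartesian_product)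
  then show ?thesis
    using distinct_card[OF distinct_ve_index, of n] by (simp add: twoN_def algebra_simps)
qed

lemma ve_state_carrier: "ve_state n x \<in> carrier_vec (twoN n)"
  by (rule carrier_vecI) (simp only: ve_state_def dim_vec_of_list length_map length_ve_index)

lemma ve_state_cong:
  assumes "\<And>k l. k \<in> {1..n} \<Longrightarrow> l \<in> {1..n} \<Longrightarrow> k \<noteq> l \<Longrightarrow> x (k,l) = y (k,l)"
  shows "ve_state n x = ve_state n y"
proof -
  have "map x (ve_index n) = map y (ve_index n)"
    by (rule map_cong[OF refl]) (use assms in \<open>auto simp: set_ve_index\<close>)
  then show ?thesis by (simp only: ve_state_def)
qed

lemma vnorm2_ve_state: "(vnorm2 (ve_state n x))\<^sup>2 = (\<Sum>p\<in>set (ve_index n). (cmod (x p))\<^sup>2)"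
proof -
  have "(vnorm2 (ve_state n x))\<^sup>2 = (\<Sum>k<length (ve_index n). (cmod (x (ve_index n ! k)))\<^sup>2)"
    by (simp add: vnorm2_def ve_state_def sum_nonneg vec_of_list_index)
  also have "\<dots> = (\<Sum>p\<in>set (ve_index n). (cmod (x p))\<^sup>2)"
    by (rule sum.reindex_bij_betw[OF bij_betw_nth[OF distinct_ve_index refl refl]])
  finally show ?thesis .
qed

lemma vnorm2_ve_state_le: "(vnorm2 (ve_state n x))\<^sup>2 \<le> nsq n x"
proof -
  have "nsq n x = (\<Sum>p\<in>{1..n} \<times> {1..n}. (cmod (x p))\<^sup>2)"
    by (simp add: nsq_def sum.cartesian_product)
  moreover have "(\<Sum>p\<in>set (ve_index n). (cmod (x p))\<^sup>2) \<le> (\<Sum>p\<in>{1..n} \<times> {1..n}. (cmod (x p))\<^sup>2)"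
    by (rule sum_mono2) (auto simp: set_ve_index)
  ultimately show ?thesis by (simp add: vnorm2_ve_state)
qed

lemma exists_map_eq:
  assumes "distinct xs" "length ys = length xs"
  shows "\<exists>f. map f xs = ys \<and> (\<forall>x. x \<notin> set xs \<longrightarrow> f x = (0::complex))"
  using assms(2,1)
proof (induction ys xs rule: list_induct2)
  case Nil
  then show ?case by auto
next
  case (Cons y ys x xs)
  then obtain f where f: "map f xs = ys" "\<forall>x. x \<notin> set xs \<longrightarrow> f x = 0" by auto
  have "map (f(x := y)) xs = ys" using f(1) Cons.prems by (metis distinct.simps(2) map_fun_upd)
  then show ?case using f(2) by (intro exI[of _ "f(x := y)"]) auto
qed

text \<open>Filling the diagonal with zeros makes the Frobenius norm of the state equal to the norm
  of the vector.\<close>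

lemma unit_vec_ve_state:
  assumes "v \<in> carrier_vec (twoN n)" "vnorm2 v \<le> 1"
  obtains x where "x \<in> unit_states n" "v = ve_state n x"
proof -
  obtain x where x: "map x (ve_index n) = list_of_vec v" "\<forall>p. p \<notin> set (ve_index n) \<longrightarrow> x p = 0"
    using exists_map_eq[OF distinct_ve_index, of "list_of_vec v" n] assms(1)
    by (auto simp: length_ve_index)
  have v: "v = ve_state n x" using x(1) by (simp only: ve_state_def vec_list)
  have "nsq n x = (\<Sum>p\<in>{1..n} \<times> {1..n}. (cmod (x p))\<^sup>2)"
    by (simp add: nsq_def sum.cartesian_product)
  also have "\<dots> = (\<Sum>p\<in>set (ve_index n). (cmod (x p))\<^sup>2)"
    by (rule sum.mono_neutral_right) (use x(2) in \<open>auto simp: set_ve_index\<close>)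
  also have "\<dots> = (vnorm2 v)\<^sup>2" by (simp add: v vnorm2_ve_state)
  also have "\<dots> \<le> 1\<^sup>2"
    using assms(2) by (intro power_mono) (auto simp: vnorm2_def intro: sum_nonneg)
  finally have "nsq n x \<le> 1" by simp
  moreover have "x p = 0" if "p \<notin> {1..n} \<times> {1..n}" for p
  proof -
    have "p \<notin> set (ve_index n)" using that by (auto simp: set_ve_index)
    then show ?thesis using x(2) by blast
  qed
  ultimately show ?thesis using that v unfolding unit_states_def by blast
qed

section \<open>Rotation matrices acting on states\<close>

lemma sum_rotJ_col:
  fixes \<phi> \<alpha> :: real
  defines "c \<equiv> complex_of_real (cos \<phi>)" and "s \<equiv> exp (\<i> * complex_of_real \<alpha>) * complex_of_real (sin \<phi>)"
  assumes "a < b" "b < n" "t < n"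
  shows "(\<Sum>v\<in>{0..<n}. f v * rotJ n (Suc a) (Suc b) \<phi> \<alpha> $$ (v,t)) =
    (if t = a then f a * c + f b * cnj s else if t = b then f b * c - f a * s else f t)"
proof -
  have cnj_s: "cnj s = exp (- \<i> * complex_of_real \<alpha>) * complex_of_real (sin \<phi>)"
    by (simp add: s_def cis_conv_exp[symmetric] cis_cnj) (simp add: cis_conv_exp)
  let ?g = "\<lambda>v. f v * rotJ n (Suc a) (Suc b) \<phi> \<alpha> $$ (v,t)"
  let ?T = "{0..<n} - {a,b}"
  have "{0..<n} = insert a (insert b ?T)" using assms by auto
  then have "sum ?g {0..<n} = sum ?g (insert a (insert b ?T))" by simp
  also have "\<dots> = ?g a + ?g b + sum ?g ?T" using assms(3) by simp
  \<comment> \<open>Outside the rows \<open>a\<close> and \<open>b\<close>, the rotation agrees with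
    the identity matrix.\<close>
  also have "sum ?g ?T = (\<Sum>v\<in>?T. if v = t then f t else 0)"
    using assms(3-5) by (intro sum.cong refl) (auto simp: rotJ_def)
  also have "\<dots> = (if t \<in> ?T then f t else 0)" by (simp add: sum.delta)
  finally show ?thesis
    using assms(3-5) cnj_s by (auto simp: rotJ_def c_def s_def)
qed

text \<open>The agreement is confined to off-diagonal positions: \<open>annul\<close> keeps the
  diagonal pivot entries, while \<open>jact\<close> deletes them.\<close>

lemma annul_rotJ_eq_jact:
  fixes \<phi> \<alpha> :: real and a b n :: nat and x :: "nat \<times> nat \<Rightarrow> complex"
  defines "U \<equiv> rotJ n (Suc a) (Suc b) \<phi> \<alpha>" and "A \<equiv> Matrix.mat n n (\<lambda>(k,l). x (Suc k, Suc l))"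
    and "s \<equiv> exp (\<i> * complex_of_real \<alpha>) * complex_of_real (sin \<phi>)"
  assumes ab: "a < b" "b < n" and kl: "k < n" "l < n" "k \<noteq> l"
  shows "annul (Suc a) (Suc b) (cadj U * A * U) $$ (k,l)
       = jact (Suc a) (Suc b) (cos \<phi>) s x (Suc k, Suc l)"
proof -
  let ?c = "complex_of_real (cos \<phi>)"
  have U: "U \<in> carrier_mat n n" and A: "A \<in> carrier_mat n n" by (auto simp: U_def A_def rotJ_def)
  then have U': "cadj U \<in> carrier_mat n n" by (auto simp: cadj_def)
  have mm: "(B * C) $$ (k,l) = (\<Sum>v\<in>{0..<n}. B $$ (k,v) * C $$ (v,l))"
    if "B \<in> carrier_mat n n" "C \<in> carrier_mat n n" "k < n" "l < n" for B C :: "complex mat" and k l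
    using that by (simp add: scalar_prod_def)
  define f where "f v = (cadj U * A) $$ (k,v)" for v
  have f: "f v = (if k = a then ?c * x (Suc a, Suc v) + s * x (Suc b, Suc v)
      else if k = b then ?c * x (Suc b, Suc v) - cnj s * x (Suc a, Suc v) else x (Suc k, Suc v))"
    if "v < n" for v
  proof -
    have "f v = (\<Sum>u\<in>{0..<n}. cnj (U $$ (u,k)) * A $$ (u,v))"
      using U kl unfolding f_def mm[OF U' A kl(1) that] by (simp add: cadj_def)
    \<comment> \<open>Conjugation turns left multiplication by the adjoint into a sum over a column
      of \<open>U\<close>, so \<open>sum_rotJ_col\<close> serves for both factors.\<close>
    also have "\<dots> = cnj (\<Sum>u\<in>{0..<n}. cnj (A $$ (u,v)) * U $$ (u,k))"
      by (simp add: mult.commute)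
    also have "\<dots> = (if k = a then ?c * x (Suc a, Suc v) + s * x (Suc b, Suc v)
      else if k = b then ?c * x (Suc b, Suc v) - cnj s * x (Suc a, Suc v) else x (Suc k, Suc v))"
      unfolding U_def sum_rotJ_col[OF ab kl(1)] s_def[symmetric]
      using ab kl that by (simp add: A_def mult.commute)
    finally show ?thesis .
  qed
  have "(cadj U * A * U) $$ (k,l) = (\<Sum>v\<in>{0..<n}. f v * U $$ (v,l))"
    unfolding f_def by (rule mm[OF mult_carrier_mat[OF U' A] U kl(1,2)])
  also have "\<dots> = (if l = a then f a * ?c + f b * cnj s else if l = b then f b * ?c - f a * s else f l)"
    unfolding U_def sum_rotJ_col[OF ab kl(2)] s_def[symmetric] ..
  finally have "(cadj U * A * U) $$ (k,l) = \<dots>" .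
  moreover have "a < n" "b < n" using ab by auto
  ultimately show ?thesis
    using U U' A kl ab f by (auto simp: annul_def jact_def mult.commute)
qed

lemma Rnu_jact:
  assumes "M \<in> Rnu n \<nu> p" "p \<in> Pn n"
  shows "\<exists>c s. \<nu> \<le> \<bar>c\<bar> \<and> c\<^sup>2 + (cmod s)\<^sup>2 = 1 \<and>
    M *\<^sub>v ve_state n x = ve_state n (jact (fst p) (snd p) c s x)"
proof -
  obtain a b where p: "p = (Suc a, Suc b)" "a < b" "b < n"
  proof -
    obtain i j where "p = (i,j)" "1 \<le> i" "i < j" "j \<le> n" using assms(2) by (auto simp: Pn_def)
    then show ?thesis by (intro that[of "i - 1" "j - 1"]) auto
  qed
  obtain \<phi> \<alpha> where c: "\<nu> \<le> \<bar>cos \<phi>\<bar>"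
    and M: "is_annihilator n (Suc a) (Suc b) (rotJ n (Suc a) (Suc b) \<phi> \<alpha>) M"
    using assms(1) by (auto simp: Rnu_def p(1))
  define s where "s = exp (\<i> * complex_of_real \<alpha>) * complex_of_real (sin \<phi>)"
  \<comment> \<open>Any state is represented off the diagonal by a matrix, to which the defining
    property of the annihilator applies.\<close>
  define A where "A = Matrix.mat n n (\<lambda>(k,l). x (Suc k, Suc l))"
  let ?U = "rotJ n (Suc a) (Suc b) \<phi> \<alpha>"
  have "cmod s = \<bar>sin \<phi>\<bar>" by (simp add: s_def norm_mult)
  then have cs: "(cos \<phi>)\<^sup>2 + (cmod s)\<^sup>2 = 1" by simp
  have "ve n A = ve_state n x"
    unfolding ve_eq by (rule ve_state_cong) (auto simp: A_def)
  then have "M *\<^sub>v ve_state n x = ve n (annul (Suc a) (Suc b) (cadj ?U * A * ?U))"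
    using M unfolding is_annihilator_def by (metis A_def mat_carrier)
  also have "\<dots> = ve_state n (jact (Suc a) (Suc b) (cos \<phi>) s x)"
    unfolding ve_eq
  proof (rule ve_state_cong)
    fix k l assume "k \<in> {1..n}" "l \<in> {1..n}" "k \<noteq> l"
    then have kl: "k - 1 < n" "l - 1 < n" "k - 1 \<noteq> l - 1" "Suc (k - 1) = k" "Suc (l - 1) = l" by auto
    show "(\<lambda>(s,t). annul (Suc a) (Suc b) (cadj ?U * A * ?U) $$ (s - 1, t - 1)) (k,l)
        = jact (Suc a) (Suc b) (cos \<phi>) s x (k,l)"
      using annul_rotJ_eq_jact[OF p(2,3) kl(1-3), of \<phi> \<alpha> x] unfolding kl(4,5) A_def s_def prod.case .
  qed
  finally show ?thesis using c cs unfolding p fst_conv snd_conv by blast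
qed

section \<open>Products of Jacobi operators and their spectral norm\<close>

lemma Jnu_carrier: "M \<in> Jnu n \<nu> Q \<Longrightarrow> M \<in> carrier_mat (twoN n) (twoN n)"
  by (induction Q arbitrary: M) (auto simp: Rnu_def is_annihilator_def intro!: mult_carrier_mat)

lemma Jnu_reach:
  assumes "set Q \<subseteq> Pn n" "M \<in> Jnu n \<nu> Q"
  shows "\<exists>y. reach \<nu> Q x y \<and> M *\<^sub>v ve_state n x = ve_state n y"
  using assms
proof (induction Q arbitrary: M x)
  case Nil
  then show ?case using ve_state_carrier by simp
next
  case (Cons p Q)
  then obtain M' R where M: "M = M' * R" "M' \<in> Jnu n \<nu> Q" "R \<in> Rnu n \<nu> p" by auto
  obtain c s where cs: "\<nu> \<le> \<bar>c\<bar>" "c\<^sup>2 + (cmod s)\<^sup>2 = 1"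
    and R: "R *\<^sub>v ve_state n x = ve_state n (jact (fst p) (snd p) c s x)"
    using Rnu_jact[OF M(3)] Cons.prems(1) by (metis list.set_intros(1) subsetD)
  obtain y where y: "reach \<nu> Q (jact (fst p) (snd p) c s x) y"
    "M' *\<^sub>v ve_state n (jact (fst p) (snd p) c s x) = ve_state n y"
    using Cons.IH[OF _ M(2)] Cons.prems(1) by auto
  have "R \<in> carrier_mat (twoN n) (twoN n)" using M(3) by (auto simp: Rnu_def is_annihilator_def)
  then have "M *\<^sub>v ve_state n x = ve_state n y"
    unfolding M(1) using assoc_mult_mat_vec[OF Jnu_carrier[OF M(2)] _ ve_state_carrier] R y(2) by simp
  then show ?case using cs y(1) by auto
qed

lemma foldr_mult_carrier:
  "set Js \<subseteq> carrier_mat m m \<Longrightarrow> foldr (*) Js (1\<^sub>m m) \<in> carrier_mat m m"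
  by (induction Js) auto

lemma sweeps_add: "sweeps (k + m) Q = sweeps k Q @ sweeps m Q"
  by (simp add: sweeps_def replicate_add)

lemma foldr_Jnu_reach:
  assumes "set Q \<subseteq> Pn n" "set Js \<subseteq> Jnu n \<nu> Q"
  shows "\<exists>y. reach \<nu> (sweeps (length Js) Q) x y \<and>
    foldr (*) Js (1\<^sub>m (twoN n)) *\<^sub>v ve_state n x = ve_state n y"
  using assms(2)
proof (induction Js)
  case Nil
  then show ?case using ve_state_carrier by (simp add: sweeps_def)
next
  case (Cons J Js)
  then obtain z where z: "reach \<nu> (sweeps (length Js) Q) x z"
    "foldr (*) Js (1\<^sub>m (twoN n)) *\<^sub>v ve_state n x = ve_state n z" by auto
  obtain y where y: "reach \<nu> Q z y" "J *\<^sub>v ve_state n z = ve_state n y"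
    using Jnu_reach[OF assms(1)] Cons.prems by (metis list.set_intros(1) subsetD)
  have "J \<in> carrier_mat (twoN n) (twoN n)" "foldr (*) Js (1\<^sub>m (twoN n)) \<in> carrier_mat (twoN n) (twoN n)"
    using Cons.prems Jnu_carrier by (auto intro!: foldr_mult_carrier)
  then have "foldr (*) (J # Js) (1\<^sub>m (twoN n)) *\<^sub>v ve_state n x = ve_state n y"
    using assoc_mult_mat_vec[OF _ _ ve_state_carrier] z(2) y(2) by simp
  \<comment> \<open>The leftmost operator acts last, so its sweep is split off at the end of the
    list.\<close>
  moreover have "reach \<nu> (sweeps (length (J # Js)) Q) x y"
    using sweeps_add[of "length Js" 1 Q] z(1) y(1) by (auto simp: reach_append sweeps_def)
  ultimately show ?case by blast
qed

lemma spec_norm_foldr_Jnu_le: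
  assumes "set Q \<subseteq> Pn n" "set Js \<subseteq> Jnu n \<nu> Q"
    "\<forall>x\<in>unit_states n. \<forall>y. reach \<nu> (sweeps (length Js) Q) x y \<longrightarrow> nsq n y \<le> \<zeta>"
  shows "spec_norm (foldr (*) Js (1\<^sub>m (twoN n))) \<le> sqrt \<zeta>"
proof -
  let ?M = "foldr (*) Js (1\<^sub>m (twoN n))"
  have M: "dim_col ?M = twoN n"
    using foldr_mult_carrier[of Js "twoN n"] assms(2) Jnu_carrier by blast
  have "vnorm2 (?M *\<^sub>v v) \<le> sqrt \<zeta>" if v: "v \<in> carrier_vec (twoN n)" "vnorm2 v \<le> 1" for v
  proof -
    obtain x where x: "x \<in> unit_states n" "v = ve_state n x" using unit_vec_ve_state[OF v] .
    obtain y where "reach \<nu> (sweeps (length Js) Q) x y" "?M *\<^sub>v v = ve_state n y"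
      using foldr_Jnu_reach[OF assms(1,2)] x(2) by blast
    then have "(vnorm2 (?M *\<^sub>v v))\<^sup>2 \<le> \<zeta>"
      using vnorm2_ve_state_le[of n y] assms(3) x(1) by force
    then show ?thesis by (rule real_le_rsqrt)
  qed
  moreover have "vnorm2 (0\<^sub>v (twoN n)) \<le> 1" by (simp add: vnorm2_def)
  ultimately show ?thesis
    unfolding spec_norm_def M by (intro cSup_least) (auto intro!: exI[of _ "0\<^sub>v (twoN n)"])
qed

text \<open>
  The number of sweeps is unbounded, as a chain may contain superfluous shifts. Taking the least
  number that admits no lossless path makes the bound independent of it.
\<close>

lemma reach_sweeps_contraction:
  assumes "is_ordering n Q" "0 < \<nu>"
  shows "\<exists>\<zeta>. 0 \<le> \<zeta> \<and> \<zeta> < 1 \<and> (\<forall>m. no_iso n (sweeps m Q) \<longrightarrow>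
    (\<forall>x\<in>unit_states n. \<forall>y. reach \<nu> (sweeps m Q) x y \<longrightarrow> nsq n y \<le> \<zeta>))"
proof (cases "\<exists>m. no_iso n (sweeps m Q)")
  case True
  define k where "k = (LEAST m. no_iso n (sweeps m Q))"
  have "no_iso n (sweeps k Q)" unfolding k_def using True by (rule LeastI_ex)
  from reach_contraction[OF set_sweeps[OF assms(1)] assms(2) this]
  obtain \<zeta> where \<zeta>: "0 \<le> \<zeta>" "\<zeta> < 1"
    "\<forall>x\<in>unit_states n. \<forall>y. reach \<nu> (sweeps k Q) x y \<longrightarrow> nsq n y \<le> \<zeta>" by blast
  have "nsq n y \<le> \<zeta>" if m: "no_iso n (sweeps m Q)" and x: "x \<in> unit_states n"
    and r: "reach \<nu> (sweeps m Q) x y" for m x y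
  proof -
    have "k \<le> m" unfolding k_def using m by (rule Least_le)
    then have "sweeps m Q = sweeps k Q @ sweeps (m - k) Q" using sweeps_add[of k "m - k" Q] by simp
    then obtain z where "reach \<nu> (sweeps k Q) x z" "reach \<nu> (sweeps (m - k) Q) z y"
      using r by (auto simp: reach_append)
    then show ?thesis using reach_nsq_le[OF set_sweeps[OF assms(1)]] \<zeta>(3) x by (meson order_trans)
  qed
  then show ?thesis using \<zeta>(1,2) by blast
next
  case False
  then show ?thesis by (intro exI[of _ 0]) auto
qed

theorem theorem3p6:
  fixes n :: nat and \<nu> :: real
  assumes "n \<ge> 2" and "0 < \<nu>" and "\<nu> \<le> 1"
  shows "\<exists>\<zeta>::real. 0 \<le> \<zeta> \<and> \<zeta> < 1 \<and>
    (\<forall>Q Q' Q'' d Js. Q \<in> Csg n \<longrightarrow> Q'' \<in> Csp n \<longrightarrow>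
       ((perm_equiv n Q Q' \<and> weak_equiv_canon n Q' Q'' d) \<or>
        (weak_equiv_canon n Q Q' d \<and> perm_equiv n Q' Q'')) \<longrightarrow>
       length Js = d + 1 \<longrightarrow> set Js \<subseteq> Jnu n \<nu> Q \<longrightarrow>
       spec_norm (foldr (*) Js (1\<^sub>m (twoN n))) \<le> \<zeta>)"
proof -
  let ?F = "{Q. is_ordering n Q}"
  have "finite (Pn n)" by (rule finite_subset[OF Pn_subset]) simp
  from finite_subset_distinct[OF this] have fin: "finite ?F"
    by (rule rev_finite_subset) (auto simp: is_ordering_def)
  have "\<forall>Q\<in>?F. \<exists>\<zeta>. 0 \<le> \<zeta> \<and> \<zeta> < 1 \<and> (\<forall>m. no_iso n (sweeps m Q) \<longrightarrow>
    (\<forall>x\<in>unit_states n. \<forall>y. reach \<nu> (sweeps m Q) x y \<longrightarrow> nsq n y \<le> \<zeta>))"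
    using reach_sweeps_contraction[OF _ assms(2)] by blast
  from bchoice[OF this] obtain \<zeta> where \<zeta>: "\<And>Q. is_ordering n Q \<Longrightarrow> 0 \<le> \<zeta> Q \<and> \<zeta> Q < 1 \<and>
    (\<forall>m. no_iso n (sweeps m Q) \<longrightarrow>
      (\<forall>x\<in>unit_states n. \<forall>y. reach \<nu> (sweeps m Q) x y \<longrightarrow> nsq n y \<le> \<zeta> Q))" by blast
  \<comment> \<open>Inserting 0 keeps the maximum nonnegative. \<open>Z\<close> bounds squared
    norms, so the constant of the theorem is its square root.\<close>
  define Z where "Z = Max (insert 0 (\<zeta> ` ?F))"
  have fin': "finite (insert 0 (\<zeta> ` ?F))" using fin by simp
  have "0 \<le> Z" unfolding Z_def using fin' by (intro Max_ge) auto
  moreover have "Z < 1" unfolding Z_def using fin' \<zeta> by (subst Max_less_iff) auto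
  moreover have "spec_norm (foldr (*) Js (1\<^sub>m (twoN n))) \<le> sqrt Z"
    if Q'': "Q'' \<in> Csp n" and rel: "(perm_equiv n Q Q' \<and> weak_equiv_canon n Q' Q'' d) \<or>
        (weak_equiv_canon n Q Q' d \<and> perm_equiv n Q' Q'')"
      and Js: "length Js = d + 1" "set Js \<subseteq> Jnu n \<nu> Q" for Q Q' Q'' d Js
  proof -
    have ord: "is_ordering n Q" and ni: "no_iso n (sweeps (d + 1) Q)"
      using no_iso_generalized_serial[OF assms(1) Q'' rel] by blast+
    have "set Q \<subseteq> Pn n" using ord by (simp add: is_ordering_def)
    then have "spec_norm (foldr (*) Js (1\<^sub>m (twoN n))) \<le> sqrt (\<zeta> Q)"
      using \<zeta>[OF ord] ni Js by (intro spec_norm_foldr_Jnu_le) auto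
    also have "\<dots> \<le> sqrt Z" unfolding Z_def using fin' ord by (intro real_sqrt_le_mono Max_ge) auto
    finally show ?thesis .
  qed
  ultimately show ?thesis by (intro exI[of _ "sqrt Z"]) auto
qed

end
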